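(* Let $G$ be a connected graph with at least two vertices. Then: (a) $\mathsf{els}_0(G)\le 0$; (b) $\mathsf{els}_1(G)=0$; (c) $\mathsf{els}_k(G)\ge 0$ for all integers $k\ge 2$.
   Context: Graphs are finite and undirected; loops and parallel edges are allowed. $V(G)$ and $E(G)$ denote the vertex and edge sets. A vertex cover of $G$ is a set $C\subseteq V(G)$ such that every edge of $G$ has at least one endpoint in $C$ (so a vertex carrying a loop lies in every vertex cover). A nucleus of $G$ is a (nonempty) connected subgraph $N\subseteq G$, given by its vertex set $V(N)$ and edge set $E(N)$, such that $V(N)$ is a vertex cover of $G$; a single vertex with no edges is allowed as a connected subgraph. $\mathcal{N}(G)$ is the set of all nuclei of $G$. For a connected graph $G$ and an integer $k\ge 0$, the $k$-th Elser number is $$\mathsf{els}_k(G)=(-1)^{|V(G)|+1}\sum_{N\in\mathcal{N}(G)}(-1)^{|E(N)|}\,|V(N)|^k.$$ *)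

theory Defs
  imports Main
begin

record ('v, 'e) mgraph =
  verts :: "'v set"
  edges :: "'e set"
  ends :: "'e \<Rightarrow> 'v set"

text \<open>Finite undirected multigraphs: an edge is an abstract label with a set of endpoints, so parallel
  edges are distinct labels with the same endpoints, and a loop is an edge with exactly one endpoint.\<close>

locale multigraph =
  fixes G :: "('v, 'e) mgraph"
  assumes finite_verts: "finite (verts G)"
    and finite_edges: "finite (edges G)"
    and ends_subset: "e \<in> edges G \<Longrightarrow> ends G e \<subseteq> verts G"
    and card_ends: "e \<in> edges G \<Longrightarrow> card (ends G e) = 1 \<or> card (ends G e) = 2"

definition adj_rel :: "('v, 'e) mgraph \<Rightarrow> ('v \<times> 'v) set" where
  "adj_rel G = {(u, v). \<exists>e\<in>edges G. ends G e = {u, v}}"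

definition connected_mgraph :: "('v, 'e) mgraph \<Rightarrow> bool" where
  "connected_mgraph G \<longleftrightarrow>
     verts G \<noteq> {} \<and> (\<forall>u\<in>verts G. \<forall>v\<in>verts G. (u, v) \<in> (adj_rel G)\<^sup>*)"

text \<open>The endpoint maps are required to agree as total functions (not only on the edges of the
  subgraph), so that a subgraph is determined by its vertex set and its edge set.\<close>

definition subgraph :: "('v, 'e) mgraph \<Rightarrow> ('v, 'e) mgraph \<Rightarrow> bool" where
  "subgraph N G \<longleftrightarrow>
     multigraph N \<and> verts N \<subseteq> verts G \<and> edges N \<subseteq> edges G \<and> ends N = ends G"

definition vertex_cover :: "('v, 'e) mgraph \<Rightarrow> 'v set \<Rightarrow> bool" where
  "vertex_cover G C \<longleftrightarrow> C \<subseteq> verts G \<and> (\<forall>e\<in>edges G. ends G e \<inter> C \<noteq> {})"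

definition nuclei :: "('v, 'e) mgraph \<Rightarrow> ('v, 'e) mgraph set" where
  "nuclei G = {N. subgraph N G \<and> connected_mgraph N \<and> vertex_cover G (verts N)}"

definition els :: "nat \<Rightarrow> ('v, 'e) mgraph \<Rightarrow> int" where
  "els k G = (-1) ^ (card (verts G) + 1) *
     (\<Sum>N\<in>nuclei G. (-1) ^ card (edges N) * int (card (verts N)) ^ k)"

lemma (in multigraph) finite_nuclei: "finite (nuclei G)"
proof (rule finite_subset)
  show "nuclei G \<subseteq>
      (\<lambda>(W, F). \<lparr>verts = W, edges = F, ends = ends G\<rparr>) ` (Pow (verts G) \<times> Pow (edges G))"
  proof
    fix N assume "N \<in> nuclei G"
    then have "verts N \<subseteq> verts G" "edges N \<subseteq> edges G"
      and "N = \<lparr>verts = verts N, edges = edges N, ends = ends G\<rparr>"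
      by (simp_all add: nuclei_def subgraph_def)
    then show "N \<in> (\<lambda>(W, F). \<lparr>verts = W, edges = F, ends = ends G\<rparr>) `
        (Pow (verts G) \<times> Pow (edges G))"
      by (intro image_eqI[where x = "(verts N, edges N)"]) auto
  qed
qed (simp add: finite_verts finite_edges)

end

theory Submission
  imports Defs
begin

text \<open>The idea is to prescribe a set \<open>U\<close> of vertices and to follow the quantity
  \<open>pinned_els G W U\<close>, which is \<open>(-1)\<close> to the power \<open>|W| + 1\<close> times the sum of \<open>(-1) ^ |E(N)|\<close> over
  the nuclei \<open>N\<close> of the induced subgraph on \<open>W\<close> with \<open>U \<subseteq> V(N)\<close>.

  Since \<open>|V(N)| ^ k\<close> counts the lists of length \<open>k\<close> with entries in \<open>V(N)\<close>, exchanging the two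
  summations writes the \<open>k\<close>-th Elser number as the sum of \<open>pinned_els G V (set xs)\<close> over all lists
  \<open>xs\<close> of \<open>k\<close> vertices of \<open>G\<close>. So it is enough to know the sign of \<open>pinned_els G V U\<close> when \<open>U\<close> is
  empty, a singleton, or any nonempty set: these settle (a), (b) and (c).

  If \<open>U = {v}\<close>, sort all edge sets \<open>F\<close> of \<open>W\<close> by the component \<open>S\<close> of \<open>v\<close>. The edges of \<open>F\<close> inside
  \<open>S\<close> connect \<open>S\<close> and those outside are arbitrary, so their signs cancel unless \<open>W - S\<close> spans no
  edge, that is, unless \<open>S\<close> is a vertex cover. The sum over the nuclei that contain \<open>v\<close> is thus the
  alternating sum over all edge sets, which is zero as soon as there is an edge
  (\<open>pinned_els_singleton\<close>). This is (b).

  Enlarging \<open>U\<close> obeys a recursion. A vertex cover that avoids \<open>x\<close> exists only if \<open>x\<close> carries no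
  loop, has to contain all neighbours of \<open>x\<close>, and is then a vertex cover of \<open>W - {x}\<close>. So, for \<open>x\<close>
  outside \<open>U\<close>, \<open>pinned_els G W (insert x U)\<close> is the sum of \<open>pinned_els G W U\<close> and, if \<open>x\<close> has no
  loop, \<open>pinned_els G (W - {x}) (U \<union> neighbours G W x)\<close>; the factor \<open>(-1)\<close> from the change of \<open>|W|\<close>
  turns the difference into a sum (\<open>pinned_els_insert\<close>). By induction along it, \<open>pinned_els G W U\<close>
  is nonnegative whenever \<open>U\<close> is nonempty and every vertex of \<open>W - U\<close> has a neighbour in \<open>W\<close>
  (\<open>pinned_els_nonneg\<close>). This gives (c). With \<open>U = {}\<close> and \<open>x = v\<close> the left-hand side of the
  recursion is zero by the singleton case, hence \<open>pinned_els G V {}\<close> is zero or the negative of a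
  nonnegative number, which is (a).\<close>

section \<open>Alternating sums over subsets\<close>

lemma sum_Pow_minus_one_power_card:
  assumes "finite A"
  shows "(\<Sum>F\<in>Pow A. (-1) ^ card F) = (if A = {} then 1 else (0::int))"
  using assms
proof (induction A rule: finite_induct)
  case (insert x A)
  have inj: "inj_on (insert x) (Pow A)"
    using insert.hyps by (auto simp: inj_on_def)
  have "(\<Sum>F\<in>insert x ` Pow A. (-1::int) ^ card F) = (\<Sum>F\<in>Pow A. (-1) ^ card (insert x F))"
    by (simp add: sum.reindex[OF inj])
  also have "\<dots> = (\<Sum>F\<in>Pow A. - ((-1) ^ card F))"
  proof (rule sum.cong[OF refl])
    fix F assume "F \<in> Pow A"
    then have "finite F" "x \<notin> F"
      using insert.hyps finite_subset by auto
    then show "(-1::int) ^ card (insert x F) = - ((-1) ^ card F)" by simp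
  qed
  finally have "(\<Sum>F\<in>insert x ` Pow A. (-1::int) ^ card F) = - (\<Sum>F\<in>Pow A. (-1) ^ card F)"
    by (simp add: sum_negf)
  moreover have "Pow A \<inter> insert x ` Pow A = {}"
    using insert.hyps by auto
  ultimately show ?case
    using insert.hyps by (simp add: Pow_insert sum.union_disjoint)
qed simp

section \<open>Connected spanning edge sets\<close>

text \<open>This is \<open>adj_rel\<close> for the edge set \<open>F\<close> alone, so that the vertex set can vary while \<open>F\<close> stays.\<close>

definition edge_rel :: "('v, 'e) mgraph \<Rightarrow> 'e set \<Rightarrow> ('v \<times> 'v) set" where
  "edge_rel G F = {(u, v). \<exists>e\<in>F. ends G e = {u, v}}"

definition component :: "('v, 'e) mgraph \<Rightarrow> 'e set \<Rightarrow> 'v \<Rightarrow> 'v set" where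
  "component G F v = (edge_rel G F)\<^sup>* `` {v}"

definition induced_edges :: "('v, 'e) mgraph \<Rightarrow> 'v set \<Rightarrow> 'e set" where
  "induced_edges G S = {e \<in> edges G. ends G e \<subseteq> S}"

definition connecting_sets :: "('v, 'e) mgraph \<Rightarrow> 'v set \<Rightarrow> 'e set set" where
  "connecting_sets G S =
     {F. F \<subseteq> induced_edges G S \<and> connected_mgraph \<lparr>verts = S, edges = F, ends = ends G\<rparr>}"

lemma induced_edges_mono: "S \<subseteq> T \<Longrightarrow> induced_edges G S \<subseteq> induced_edges G T"
  by (auto simp: induced_edges_def)

lemma edge_rel_mono: "F \<subseteq> F' \<Longrightarrow> edge_rel G F \<subseteq> edge_rel G F'"
  by (auto simp: edge_rel_def)

lemma sym_edge_rel: "sym (edge_rel G F)"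
  by (auto simp: sym_def edge_rel_def insert_commute)

lemma mem_component_self: "v \<in> component G F v"
  by (simp add: component_def)

lemma component_mono: "F \<subseteq> F' \<Longrightarrow> component G F v \<subseteq> component G F' v"
  unfolding component_def using rtrancl_mono[OF edge_rel_mono] by blast

lemma component_subsetI:
  assumes "v \<in> S" and "\<And>a b. (a, b) \<in> edge_rel G F \<Longrightarrow> a \<in> S \<Longrightarrow> b \<in> S"
  shows "component G F v \<subseteq> S"
proof
  fix w assume "w \<in> component G F v"
  then have "(v, w) \<in> (edge_rel G F)\<^sup>*" by (simp add: component_def)
  then show "w \<in> S"
    by (induction rule: rtrancl_induct) (use assms in auto)
qed

lemma component_step:
  "a \<in> component G F v \<Longrightarrow> (a, b) \<in> edge_rel G F \<Longrightarrow> b \<in> component G F v"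
  by (auto simp: component_def intro: rtrancl_into_rtrancl)

text \<open>Connectedness seen from one root: since adjacency is symmetric, it is enough that the component
  of a single vertex is everything. This makes the sorting of edge sets by the component of a root
  compatible with a notion of connectedness that mentions no root.\<close>

lemma connecting_sets_iff_component:
  assumes "v \<in> S"
  shows "F \<in> connecting_sets G S \<longleftrightarrow> F \<subseteq> induced_edges G S \<and> component G F v = S"
proof -
  have rel: "adj_rel \<lparr>verts = S, edges = F, ends = ends G\<rparr> = edge_rel G F"
    by (simp add: adj_rel_def edge_rel_def)
  have sub: "component G F v \<subseteq> S" if "F \<subseteq> induced_edges G S"
    by (rule component_subsetI[OF assms])
      (use that in \<open>auto simp: edge_rel_def induced_edges_def\<close>)
  have "(u, w) \<in> (edge_rel G F)\<^sup>*" if "component G F v = S" "u \<in> S" "w \<in> S" for u w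
  proof -
    have "(v, u) \<in> (edge_rel G F)\<^sup>*" "(v, w) \<in> (edge_rel G F)\<^sup>*"
      using that by (auto simp: component_def)
    moreover have "sym ((edge_rel G F)\<^sup>*)" by (intro sym_rtrancl sym_edge_rel)
    ultimately show ?thesis by (meson symD rtrancl_trans)
  qed
  moreover have "S \<subseteq> component G F v" if "\<forall>u\<in>S. \<forall>w\<in>S. (u, w) \<in> (edge_rel G F)\<^sup>*"
    using that assms by (auto simp: component_def)
  ultimately show ?thesis
    using assms sub unfolding connecting_sets_def connected_mgraph_def mem_Collect_eq
      mgraph.simps rel
    by blast
qed

text \<open>Loops do not make a vertex its own neighbour, so a vertex without neighbours is one that no edge
  joins to the rest of \<open>W\<close>.\<close>

definition neighbours :: "('v, 'e) mgraph \<Rightarrow> 'v set \<Rightarrow> 'v \<Rightarrow> 'v set" where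
  "neighbours G W x = {y \<in> W. y \<noteq> x \<and> (\<exists>e\<in>edges G. ends G e = {x, y})}"

text \<open>Deleting \<open>x\<close> can only take away \<open>x\<close> from the neighbours of \<open>y\<close>. As the
  recursion also prescribes the neighbours of \<open>x\<close>, it creates no isolated vertex outside of the
  prescribed set.\<close>

lemma neighbours_delete_nonempty:
  assumes "neighbours G W y \<noteq> {}" "y \<in> W" "y \<noteq> x" "y \<notin> neighbours G W x"
  shows "neighbours G (W - {x}) y \<noteq> {}"
proof -
  obtain z where z: "z \<in> neighbours G W y" using assms(1) by blast
  then have "z \<noteq> x" using assms by (auto simp: neighbours_def insert_commute)
  then show ?thesis using z by (auto simp: neighbours_def)
qed

lemma connecting_sets_eq_empty:
  assumes "x \<in> S" "v \<in> S" "x \<noteq> v" "neighbours G S x = {}"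
  shows "connecting_sets G S = {}"
proof -
  have small: "component G F x \<subseteq> {x}" if "F \<subseteq> induced_edges G S" for F
    by (rule component_subsetI)
      (use that assms in \<open>auto simp: edge_rel_def induced_edges_def neighbours_def\<close>)
  have "F \<notin> connecting_sets G S" for F
    using small[of F] assms(2,3) by (auto simp: connecting_sets_iff_component[OF assms(1)])
  then show ?thesis by blast
qed

section \<open>Signed sums over the nuclei of an induced subgraph\<close>

definition connecting_sum :: "('v, 'e) mgraph \<Rightarrow> 'v set \<Rightarrow> int" where
  "connecting_sum G S = (\<Sum>F\<in>connecting_sets G S. (-1) ^ card F)"

text \<open>The vertex covers of the subgraph induced on \<open>W\<close> that contain \<open>U\<close>, phrased through their
  independent complements.\<close>

definition induced_covers :: "('v, 'e) mgraph \<Rightarrow> 'v set \<Rightarrow> 'v set \<Rightarrow> 'v set set" where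
  "induced_covers G W U = {S. U \<subseteq> S \<and> S \<subseteq> W \<and> induced_edges G (W - S) = {}}"

definition pinned_els :: "('v, 'e) mgraph \<Rightarrow> 'v set \<Rightarrow> 'v set \<Rightarrow> int" where
  "pinned_els G W U = (-1) ^ (card W + 1) * (\<Sum>S\<in>induced_covers G W U. connecting_sum G S)"

context multigraph
begin

lemma finite_induced_edges: "finite (induced_edges G S)"
  using finite_edges by (simp add: induced_edges_def)

lemma finite_induced_covers: "finite W \<Longrightarrow> finite (induced_covers G W U)"
  by (rule finite_subset[of _ "Pow W"]) (auto simp: induced_covers_def)

lemma edge_endsE:
  assumes "e \<in> edges G"
  obtains a b where "ends G e = {a, b}"
  using card_ends[OF assms] by (auto simp: card_1_singleton_iff card_2_iff)

lemma edge_at_endE: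
  assumes "e \<in> edges G" "x \<in> ends G e"
  obtains y where "ends G e = {x, y}"
proof -
  obtain a b where ab: "ends G e = {a, b}"
    using edge_endsE[OF assms(1)] .
  then have "ends G e = {x, if x = a then b else a}"
    using assms(2) by auto
  then show thesis by (rule that)
qed

lemma induced_edges_disjoint:
  assumes "S \<inter> T = {}"
  shows "induced_edges G S \<inter> induced_edges G T = {}"
proof -
  have "ends G e \<noteq> {}" if "e \<in> edges G" for e
    using card_ends[OF that] by auto
  then show ?thesis using assms by (fastforce simp: induced_edges_def)
qed

text \<open>The edges of \<open>W\<close> split along \<open>S\<close> because an edge leaving \<open>S\<close> would enlarge the component of
  \<open>v\<close>. Inside \<open>S\<close> the edge set has to be connecting, and outside \<open>S\<close> it is arbitrary.\<close>

lemma bij_betw_edge_sets_with_component: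
  assumes "v \<in> S" "S \<subseteq> W"
  shows "bij_betw (\<lambda>(A, B). A \<union> B) (connecting_sets G S \<times> Pow (induced_edges G (W - S)))
    {F \<in> Pow (induced_edges G W). component G F v = S}"
proof (rule bij_betw_byWitness[where f' = "\<lambda>F. (F \<inter> induced_edges G S, F \<inter> induced_edges G (W - S))"])
  have disj: "induced_edges G S \<inter> induced_edges G (W - S) = {}"
    by (rule induced_edges_disjoint) auto
  show "\<forall>p\<in>connecting_sets G S \<times> Pow (induced_edges G (W - S)).
     (\<lambda>F. (F \<inter> induced_edges G S, F \<inter> induced_edges G (W - S))) ((\<lambda>(A, B). A \<union> B) p) = p"
    using disj by (auto simp: connecting_sets_def)
  have split: "F = F \<inter> induced_edges G S \<union> F \<inter> induced_edges G (W - S)"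
    if F: "F \<subseteq> induced_edges G W" "component G F v = S" for F
  proof -
    have "e \<in> induced_edges G S \<union> induced_edges G (W - S)" if e: "e \<in> F" for e
    proof -
      have eW: "e \<in> edges G" "ends G e \<subseteq> W"
        using F e by (auto simp: induced_edges_def)
      obtain a b where ab: "ends G e = {a, b}"
        using edge_endsE[OF eW(1)] .
      then have "(a, b) \<in> edge_rel G F" "(b, a) \<in> edge_rel G F"
        using e by (auto simp: edge_rel_def insert_commute)
      then have "a \<in> S \<longleftrightarrow> b \<in> S"
        using F(2) component_step by metis
      then show ?thesis
        using eW ab by (auto simp: induced_edges_def)
    qed
    then show ?thesis by blast
  qed
  then show "\<forall>F\<in>{F \<in> Pow (induced_edges G W). component G F v = S}.
     (\<lambda>(A, B). A \<union> B) (F \<inter> induced_edges G S, F \<inter> induced_edges G (W - S)) = F"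
    by auto
  have union: "component G (A \<union> B) v = component G A v"
    if "A \<subseteq> induced_edges G S" "B \<subseteq> induced_edges G (W - S)" for A B
  proof
    have inside: "component G A v \<subseteq> S"
      by (rule component_subsetI[OF assms(1)])
        (use that in \<open>auto simp: edge_rel_def induced_edges_def\<close>)
    show "component G (A \<union> B) v \<subseteq> component G A v"
    proof (rule component_subsetI[OF mem_component_self])
      fix a b assume ab: "(a, b) \<in> edge_rel G (A \<union> B)" and a: "a \<in> component G A v"
      then have "(a, b) \<in> edge_rel G A"
        using inside that by (fastforce simp: edge_rel_def induced_edges_def)
      then show "b \<in> component G A v" using a component_step by metis
    qed
  qed (simp add: component_mono)
  show "(\<lambda>(A, B). A \<union> B) ` (connecting_sets G S \<times> Pow (induced_edges G (W - S)))
     \<subseteq> {F \<in> Pow (induced_edges G W). component G F v = S}"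
  proof clarify
    fix A B assume A: "A \<in> connecting_sets G S" and B: "B \<subseteq> induced_edges G (W - S)"
    have "A \<subseteq> induced_edges G S" "component G A v = S"
      using A by (simp_all add: connecting_sets_iff_component[OF assms(1)])
    moreover have "induced_edges G S \<subseteq> induced_edges G W" "induced_edges G (W - S) \<subseteq> induced_edges G W"
      using assms(2) by (auto intro!: induced_edges_mono)
    ultimately show "A \<union> B \<in> Pow (induced_edges G W) \<and> component G (A \<union> B) v = S"
      using union[of A B] B by auto
  qed
  show "(\<lambda>F. (F \<inter> induced_edges G S, F \<inter> induced_edges G (W - S))) `
      {F \<in> Pow (induced_edges G W). component G F v = S}
     \<subseteq> connecting_sets G S \<times> Pow (induced_edges G (W - S))"
  proof (rule image_subsetI)
    fix F assume "F \<in> {F \<in> Pow (induced_edges G W). component G F v = S}"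
    then have F: "F \<subseteq> induced_edges G W" "component G F v = S" by auto
    have "component G (F \<inter> induced_edges G S) v = S"
      using union[of "F \<inter> induced_edges G S" "F \<inter> induced_edges G (W - S)"] split[of F] F by auto
    then show "(F \<inter> induced_edges G S, F \<inter> induced_edges G (W - S))
        \<in> connecting_sets G S \<times> Pow (induced_edges G (W - S))"
      by (simp add: connecting_sets_iff_component[OF assms(1)])
  qed
qed

text \<open>The signs factor over the two parts of the splitting, and the free part outside \<open>S\<close> contributes an
  alternating sum over a power set, which is what singles out the vertex covers.\<close>

lemma sum_edge_sets_with_component:
  assumes "v \<in> S" "S \<subseteq> W"
  shows "(\<Sum>F | F \<in> Pow (induced_edges G W) \<and> component G F v = S. (-1) ^ card F) =
    (if induced_edges G (W - S) = {} then connecting_sum G S else 0)"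
proof -
  let ?B = "Pow (induced_edges G (W - S))"
  have "(\<Sum>F | F \<in> Pow (induced_edges G W) \<and> component G F v = S. (-1::int) ^ card F) =
      (\<Sum>(A, B)\<in>connecting_sets G S \<times> ?B. (-1) ^ card (A \<union> B))"
    by (subst sum.reindex_bij_betw[OF bij_betw_edge_sets_with_component[OF assms], symmetric])
      (simp add: case_prod_unfold)
  also have "\<dots> = (\<Sum>(A, B)\<in>connecting_sets G S \<times> ?B. (-1) ^ card A * (-1) ^ card B)"
  proof (rule sum.cong[OF refl], clarify)
    fix A B assume A: "A \<in> connecting_sets G S" and B: "B \<subseteq> induced_edges G (W - S)"
    have A': "A \<subseteq> induced_edges G S" using A by (simp add: connecting_sets_def)
    have "finite A" "finite B"
      using A' B finite_induced_edges finite_subset by blast+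
    moreover have "A \<inter> B = {}"
      using A' B induced_edges_disjoint[of S "W - S"] by blast
    ultimately show "(-1::int) ^ card (A \<union> B) = (-1) ^ card A * (-1) ^ card B"
      by (simp add: card_Un_disjoint power_add)
  qed
  also have "\<dots> = connecting_sum G S * (\<Sum>B\<in>?B. (-1) ^ card B)"
    by (simp add: connecting_sum_def sum_product sum.cartesian_product)
  also have "\<dots> = (if induced_edges G (W - S) = {} then connecting_sum G S else 0)"
    by (simp add: sum_Pow_minus_one_power_card[OF finite_induced_edges])
  finally show ?thesis .
qed

text \<open>Every edge set of \<open>W\<close> has exactly one component of \<open>v\<close>, so adding up the previous identity over
  \<open>S\<close> gives the alternating sum over all edge sets.\<close>

lemma pinned_els_singleton:
  assumes "finite W" "v \<in> W"
  shows "pinned_els G W {v} = (if induced_edges G W = {} then (-1) ^ (card W + 1) else 0)"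
proof -
  let ?T = "{S. v \<in> S \<and> S \<subseteq> W}"
  have fin: "finite ?T"
    by (rule finite_subset[of _ "Pow W"]) (use assms in auto)
  have "component G F v \<subseteq> W" if "F \<subseteq> induced_edges G W" for F
    by (rule component_subsetI[OF assms(2)])
      (use that in \<open>auto simp: edge_rel_def induced_edges_def\<close>)
  then have comp: "(\<lambda>F. component G F v) ` Pow (induced_edges G W) \<subseteq> ?T"
    by (auto simp: mem_component_self)
  have "(\<Sum>F\<in>Pow (induced_edges G W). (-1) ^ card F) =
     (\<Sum>S\<in>?T. \<Sum>F | F \<in> Pow (induced_edges G W) \<and> component G F v = S. (-1::int) ^ card F)"
    by (rule sum.group[symmetric]) (use fin comp in \<open>auto simp: finite_induced_edges\<close>)
  also have "\<dots> = (\<Sum>S\<in>?T. if induced_edges G (W - S) = {} then connecting_sum G S else 0)"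
    by (rule sum.cong[OF refl], rule sum_edge_sets_with_component) auto
  also have "\<dots> = (\<Sum>S | S \<in> ?T \<and> induced_edges G (W - S) = {}. connecting_sum G S)"
    using fin by (rule sum.inter_filter[symmetric])
  also have "{S. S \<in> ?T \<and> induced_edges G (W - S) = {}} = induced_covers G W {v}"
    by (auto simp: induced_covers_def)
  finally have "(\<Sum>S\<in>induced_covers G W {v}. connecting_sum G S) =
      (if induced_edges G W = {} then 1 else 0)"
    unfolding sum_Pow_minus_one_power_card[OF finite_induced_edges] by (rule sym)
  then show ?thesis
    unfolding pinned_els_def by simp
qed

text \<open>A cover that misses \<open>x\<close> must contain the other end of each edge at \<open>x\<close>. In particular there is no
  such cover if \<open>x\<close> has a loop; otherwise the edges at \<open>x\<close> are taken care of by the neighbours and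
  only the edges of \<open>W - {x}\<close> remain to be covered.\<close>

lemma induced_covers_avoiding:
  assumes "x \<in> W"
  shows "{S \<in> induced_covers G W U. x \<notin> S} =
    (if x \<in> U \<or> induced_edges G {x} \<noteq> {} then {}
     else induced_covers G (W - {x}) (U \<union> neighbours G W x))"
proof (cases "x \<in> U \<or> induced_edges G {x} \<noteq> {}")
  case True
  have "x \<in> S" if S: "S \<in> induced_covers G W U" for S
  proof (rule ccontr)
    assume "x \<notin> S"
    then have "induced_edges G {x} \<subseteq> induced_edges G (W - S)"
      using assms by (intro induced_edges_mono) auto
    then show False
      using True S \<open>x \<notin> S\<close> by (auto simp: induced_covers_def)
  qed
  then show ?thesis
    using True by auto
next
  case False
  have "S \<in> induced_covers G (W - {x}) (U \<union> neighbours G W x)"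
    if S: "S \<in> induced_covers G W U" "x \<notin> S" for S
  proof -
    have "neighbours G W x \<subseteq> S"
    proof
      fix y assume "y \<in> neighbours G W x"
      then obtain e where e: "y \<in> W" "e \<in> edges G" "ends G e = {x, y}"
        by (auto simp: neighbours_def)
      have "\<not> ends G e \<subseteq> W - S"
        using S e(2) by (auto simp: induced_covers_def induced_edges_def)
      then show "y \<in> S"
        using e S(2) assms by simp
    qed
    moreover have "induced_edges G (W - {x} - S) \<subseteq> induced_edges G (W - S)"
      by (rule induced_edges_mono) auto
    ultimately show ?thesis
      using S by (auto simp: induced_covers_def)
  qed
  moreover have "S \<in> induced_covers G W U \<and> x \<notin> S"
    if S: "S \<in> induced_covers G (W - {x}) (U \<union> neighbours G W x)" for S
  proof -
    have "False" if e: "e \<in> induced_edges G (W - S)" for e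
    proof -
      have e': "e \<in> edges G" "ends G e \<subseteq> W - S"
        using e by (auto simp: induced_edges_def)
      have "x \<in> ends G e"
        using S e' by (auto simp: induced_covers_def induced_edges_def)
      then obtain y where y: "ends G e = {x, y}"
        using edge_at_endE[OF e'(1)] by metis
      have "y \<noteq> x"
        using False y e' by (auto simp: induced_edges_def)
      then have "y \<in> neighbours G W x"
        using y e' by (auto simp: neighbours_def)
      then show False
        using S y e' by (auto simp: induced_covers_def)
    qed
    then show ?thesis
      using S by (auto simp: induced_covers_def)
  qed
  ultimately show ?thesis
    using False by (simp only: if_False) blast
qed

lemma pinned_els_insert:
  assumes "finite W" "x \<in> W" "x \<notin> U"
  shows "pinned_els G W (insert x U) = pinned_els G W U +
    (if induced_edges G {x} = {} then pinned_els G (W - {x}) (U \<union> neighbours G W x) else 0)"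
proof -
  let ?C = "induced_covers G W U"
  let ?sum = "\<Sum>S\<in>induced_covers G (W - {x}) (U \<union> neighbours G W x). connecting_sum G S"
  have "induced_covers G W (insert x U) = {S \<in> ?C. x \<in> S}"
    by (auto simp: induced_covers_def)
  then have "(\<Sum>S\<in>?C. connecting_sum G S) =
     (\<Sum>S\<in>induced_covers G W (insert x U). connecting_sum G S) +
     (\<Sum>S | S \<in> ?C \<and> x \<notin> S. connecting_sum G S)"
    using sum.Int_Diff[OF finite_induced_covers[OF assms(1)], of "connecting_sum G" U "{S. x \<in> S}"]
    by (simp add: Int_def set_diff_eq)
  also have "(\<Sum>S | S \<in> ?C \<and> x \<notin> S. connecting_sum G S) =
     (if induced_edges G {x} = {} then ?sum else 0)"
    using assms(3) by (simp only: induced_covers_avoiding[OF assms(2)]) auto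
  finally have split: "(\<Sum>S\<in>?C. connecting_sum G S) =
     (\<Sum>S\<in>induced_covers G W (insert x U). connecting_sum G S) +
     (if induced_edges G {x} = {} then ?sum else 0)" .
  have "(-1::int) ^ (card (W - {x}) + 1) = - ((-1) ^ (card W + 1))"
    unfolding card.remove[OF assms(1,2)] by simp
  then show ?thesis
    unfolding pinned_els_def split by (simp only: distrib_left) (cases "induced_edges G {x} = {}"; simp)
qed

text \<open>No connected subgraph contains an isolated vertex together with another one.\<close>

lemma pinned_els_isolated:
  assumes "x \<in> U" "v \<in> U" "x \<noteq> v" "neighbours G W x = {}"
  shows "pinned_els G W U = 0"
proof -
  have "connecting_sum G S = 0" if "S \<in> induced_covers G W U" for S
  proof -
    have S: "U \<subseteq> S" "S \<subseteq> W"
      using that by (simp_all add: induced_covers_def)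
    then have "x \<in> S" "v \<in> S"
      using assms by auto
    moreover have "neighbours G S x = {}"
      using S(2) assms(4) unfolding neighbours_def by blast
    ultimately show ?thesis
      using assms(3) by (simp add: connecting_sum_def connecting_sets_eq_empty[of x S v])
  qed
  then show ?thesis by (simp add: pinned_els_def)
qed

text \<open>Without the condition on the neighbours this fails: on \<open>n\<close> vertices without edges,
  \<open>pinned_els_singleton\<close> gives a negative value for even \<open>n\<close>. Splitting off a vertex of \<open>U\<close> that has
  a neighbour preserves the condition in both terms of the recursion, and for a vertex without
  neighbours the value is zero by the previous lemma. The outer induction is on \<open>W\<close>, the inner one on
  \<open>U\<close>, since the second term of the recursion has a smaller \<open>W\<close> but possibly a larger \<open>U\<close>.\<close>

lemma pinned_els_nonneg:
  assumes "finite W" "U \<subseteq> W" "U \<noteq> {}" "\<And>y. y \<in> W - U \<Longrightarrow> neighbours G W y \<noteq> {}"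
  shows "pinned_els G W U \<ge> 0"
  using assms
proof (induction W arbitrary: U rule: finite_psubset_induct)
  case (psubset W)
  have "finite U" using psubset.prems psubset.hyps finite_subset by blast
  then show ?case
    using psubset.prems(2,1,3)
  proof (induction U rule: finite_ne_induct)
    case (singleton v)
    show ?case
    proof (cases "W = {v}")
      case False
      then obtain y where y: "y \<in> W - {v}" using singleton.prems by auto
      then obtain z where "z \<in> neighbours G W y" using singleton.prems(2) by blast
      then have "induced_edges G W \<noteq> {}"
        using y by (auto simp: neighbours_def induced_edges_def)
      then show ?thesis
        using singleton.prems psubset.hyps by (simp add: pinned_els_singleton)
    qed (simp add: pinned_els_singleton)
  next
    case (insert x U)
    have x: "x \<in> W" using insert.prems by auto
    show ?case
    proof (cases "neighbours G W x = {}")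
      case True
      obtain v where "v \<in> U" "x \<noteq> v" using insert.hyps by blast
      then show ?thesis
        using pinned_els_isolated[of x "insert x U" v W] True by simp
    next
      case False
      have "pinned_els G W U \<ge> 0"
        by (rule insert.IH) (use insert.prems False in auto)
      moreover have "pinned_els G (W - {x}) (U \<union> neighbours G W x) \<ge> 0"
      proof (rule psubset.IH)
        show "U \<union> neighbours G W x \<subseteq> W - {x}"
          using insert.prems insert.hyps by (auto simp: neighbours_def)
        show "neighbours G (W - {x}) y \<noteq> {}" if "y \<in> W - {x} - (U \<union> neighbours G W x)" for y
          using that insert.prems(2)[of y] by (intro neighbours_delete_nonempty) auto
      qed (use x insert.hyps in auto)
      ultimately show ?thesis
        using pinned_els_insert[OF psubset.hyps(1) x insert.hyps(3)] by simp
    qed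
  qed
qed

section \<open>Elser numbers as sums over lists of vertices\<close>

lemma sum_nuclei:
  "(\<Sum>N\<in>nuclei G. (-1) ^ card (edges N) * int (card (verts N)) ^ k) =
   (\<Sum>S\<in>induced_covers G (verts G) {}. connecting_sum G S * int (card S) ^ k)"
proof -
  let ?C = "induced_covers G (verts G) {}"
  let ?graph = "\<lambda>(S, F). \<lparr>verts = S, edges = F, ends = ends G\<rparr>"
  have cover: "vertex_cover G S \<longleftrightarrow> S \<in> ?C" for S
  proof -
    have "ends G e \<inter> S \<noteq> {} \<longleftrightarrow> \<not> ends G e \<subseteq> verts G - S" if "e \<in> edges G" for e
      using ends_subset[OF that] by blast
    then show ?thesis
      by (auto simp: vertex_cover_def induced_covers_def induced_edges_def)
  qed
  have sub: "subgraph (?graph (S, F)) G \<longleftrightarrow> F \<subseteq> induced_edges G S" if "S \<subseteq> verts G" for S F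
  proof -
    have "finite S" "finite F" if "F \<subseteq> induced_edges G S"
      using that \<open>S \<subseteq> verts G\<close> finite_verts finite_induced_edges finite_subset by blast+
    then show ?thesis
      using that card_ends by (auto simp: subgraph_def multigraph_def induced_edges_def)
  qed
  have mem: "?graph (S, F) \<in> nuclei G \<longleftrightarrow> S \<in> ?C \<and> F \<in> connecting_sets G S" for S F
    using cover[of S] sub[of S F]
    by (auto simp: nuclei_def connecting_sets_def vertex_cover_def subgraph_def)
  have "nuclei G = ?graph ` Sigma ?C (connecting_sets G)"
  proof (intro equalityI subsetI)
    fix N assume N: "N \<in> nuclei G"
    then have eq: "N = ?graph (verts N, edges N)"
      by (simp add: nuclei_def subgraph_def)
    then have "(verts N, edges N) \<in> Sigma ?C (connecting_sets G)"
      using N mem[of "verts N" "edges N"] by simp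
    then show "N \<in> ?graph ` Sigma ?C (connecting_sets G)"
      using eq by blast
  next
    fix N assume "N \<in> ?graph ` Sigma ?C (connecting_sets G)"
    then show "N \<in> nuclei G" using mem by auto
  qed
  moreover have "inj_on ?graph (Sigma ?C (connecting_sets G))"
    by (auto simp: inj_on_def)
  ultimately have "(\<Sum>N\<in>nuclei G. (-1) ^ card (edges N) * int (card (verts N)) ^ k) =
      (\<Sum>(S, F)\<in>Sigma ?C (connecting_sets G). (-1) ^ card F * int (card S) ^ k)"
    by (simp add: sum.reindex case_prod_unfold)
  also have "\<dots> = (\<Sum>S\<in>?C. \<Sum>F\<in>connecting_sets G S. (-1) ^ card F * int (card S) ^ k)"
  proof (rule sum.Sigma[symmetric])
    show "finite ?C" by (rule finite_induced_covers[OF finite_verts])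
    show "\<forall>S\<in>?C. finite (connecting_sets G S)"
      unfolding connecting_sets_def by (simp add: finite_induced_edges)
  qed
  finally show ?thesis
    by (simp add: connecting_sum_def sum_distrib_right)
qed

text \<open>Here \<open>|S| ^ k\<close> is replaced by the number of lists of length \<open>k\<close> over \<open>S\<close>; then the sum over the list
  is taken out in front of the sum over \<open>S\<close>. For \<open>k = 0\<close> only the empty
  list remains, and with it the empty prescribed set.\<close>

lemma els_eq_sum_pinned_els:
  "els k G = (\<Sum>xs | set xs \<subseteq> verts G \<and> length xs = k. pinned_els G (verts G) (set xs))"
proof -
  let ?C = "induced_covers G (verts G) {}"
  let ?L = "{xs. set xs \<subseteq> verts G \<and> length xs = k}"
  have fin: "finite ?L" "finite ?C"
    using finite_verts by (auto intro: finite_lists_length_eq finite_induced_covers)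
  have "connecting_sum G S * int (card S) ^ k =
      (\<Sum>xs | xs \<in> ?L \<and> set xs \<subseteq> S. connecting_sum G S)" if S: "S \<in> ?C" for S
  proof -
    have "S \<subseteq> verts G" using S by (simp add: induced_covers_def)
    then have "{xs. xs \<in> ?L \<and> set xs \<subseteq> S} = {xs. set xs \<subseteq> S \<and> length xs = k}" by auto
    moreover have "card {xs. set xs \<subseteq> S \<and> length xs = k} = card S ^ k"
      using \<open>S \<subseteq> verts G\<close> finite_verts by (intro card_lists_length_eq) (rule finite_subset)
    ultimately show ?thesis by simp
  qed
  then have "(\<Sum>S\<in>?C. connecting_sum G S * int (card S) ^ k) =
      (\<Sum>S\<in>?C. \<Sum>xs | xs \<in> ?L \<and> set xs \<subseteq> S. connecting_sum G S)"
    by (rule sum.cong[OF refl])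
  also have "\<dots> = (\<Sum>xs\<in>?L. \<Sum>S | S \<in> ?C \<and> set xs \<subseteq> S. connecting_sum G S)"
    by (rule sum.swap_restrict[OF fin(2) fin(1)])
  also have "\<dots> = (\<Sum>xs\<in>?L. \<Sum>S\<in>induced_covers G (verts G) (set xs). connecting_sum G S)"
    by (intro sum.cong) (auto simp: induced_covers_def)
  finally show ?thesis
    by (simp add: els_def sum_nuclei pinned_els_def sum_distrib_left)
qed

section \<open>Signs of the Elser numbers\<close>

text \<open>A path that starts at a vertex without neighbours never leaves it.\<close>

lemma neighbours_nonempty:
  assumes "connected_mgraph G" "card (verts G) \<ge> 2" "x \<in> verts G"
  shows "neighbours G (verts G) x \<noteq> {}"
proof
  assume none: "neighbours G (verts G) x = {}"
  have "verts G \<noteq> {x}" using assms(2) by auto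
  then obtain y where y: "y \<in> verts G" "y \<noteq> x"
    using assms(3) by blast
  have "(x, y) \<in> (adj_rel G)\<^sup>*"
    using assms(1,3) y by (simp add: connected_mgraph_def)
  then have "y = x"
  proof (induction rule: rtrancl_induct)
    case (step a b)
    then obtain e where e: "e \<in> edges G" "ends G e = {x, b}" by (auto simp: adj_rel_def)
    then have "b \<in> verts G" using ends_subset[of e] by simp
    then show ?case
      using none e unfolding neighbours_def by blast
  qed simp
  then show False using y by simp
qed

end

theorem theorem1p1:
  fixes G :: "('v, 'e) mgraph"
  assumes "multigraph G"
    and "connected_mgraph G"
    and "card (verts G) \<ge> 2"
  shows "els 0 G \<le> 0 \<and> els 1 G = 0 \<and> (\<forall>k\<ge>2. els k G \<ge> 0)"
proof -
  interpret multigraph G by fact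
  let ?V = "verts G"
  note nbr = neighbours_nonempty[OF assms(2,3)]
  have single: "pinned_els G ?V {v} = 0" if v: "v \<in> ?V" for v
  proof -
    obtain e where "e \<in> edges G" using nbr[OF v] by (auto simp: neighbours_def)
    then have "induced_edges G ?V \<noteq> {}" using ends_subset by (auto simp: induced_edges_def)
    then show ?thesis by (simp add: pinned_els_singleton[OF finite_verts v])
  qed
  have "els 0 G \<le> 0"
  proof -
    obtain v where v: "v \<in> ?V" using assms(2) by (auto simp: connected_mgraph_def)
    have "pinned_els G (?V - {v}) (neighbours G ?V v) \<ge> 0"
    proof (rule pinned_els_nonneg)
      show "neighbours G (?V - {v}) y \<noteq> {}" if "y \<in> ?V - {v} - neighbours G ?V v" for y
        using that nbr[of y] by (intro neighbours_delete_nonempty) auto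
    qed (use nbr[OF v] finite_verts in \<open>auto simp: neighbours_def\<close>)
    moreover have "els 0 G = pinned_els G ?V {}"
    proof -
      have "{xs. set xs \<subseteq> ?V \<and> length xs = 0} = {[]}" by auto
      then show ?thesis by (simp add: els_eq_sum_pinned_els)
    qed
    \<comment> \<open>The recursion from \<open>{}\<close> to \<open>{v}\<close> has left-hand side zero.\<close>
    ultimately show ?thesis
      using pinned_els_insert[OF finite_verts v, of "{}"] single[OF v] by (auto split: if_splits)
  qed
  moreover have "els 1 G = 0"
    unfolding els_eq_sum_pinned_els
    by (rule sum.neutral) (auto simp: length_Suc_conv single)
  moreover have "els k G \<ge> 0" if "k \<ge> 2" for k
    unfolding els_eq_sum_pinned_els
  proof (rule sum_nonneg)
    fix xs assume "xs \<in> {xs. set xs \<subseteq> ?V \<and> length xs = k}"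
    then show "pinned_els G ?V (set xs) \<ge> 0"
      using that nbr by (intro pinned_els_nonneg finite_verts) auto
  qed
  ultimately show ?thesis by blast
qed

end
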